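(* Let $m\ge2$, let $K_1,\dots,K_m\subset\mathbb R^n$ be convex bodies and let $\theta\in[0,1]$. Then $$|K_1+_\theta\cdots+_\theta K_m|^{\frac1n}\ \ge\ \left(1-\theta^{\frac1{(m-1)n}}\right)\left(|K_1|^{\frac1n}+\cdots+|K_m|^{\frac1n}\right).$$
   Context: A convex body in $\mathbb R^n$ is a compact convex set with non-empty interior; $|\cdot|$ denotes Lebesgue measure; $\chi_K$ is the characteristic function of $K$ and $\ast$ is convolution of functions on $\mathbb R^n$. For convex bodies $K_1,\dots,K_m$ put $M(K_1,\dots,K_m)=\max_{x\in\mathbb R^n}\chi_{K_1}\ast\cdots\ast\chi_{K_m}(x)$ and, for $\theta\in[0,1]$, $$K_1+_\theta\cdots+_\theta K_m=\{x\in K_1+\cdots+K_m:\ \chi_{K_1}\ast\cdots\ast\chi_{K_m}(x)\ge\theta M(K_1,\dots,K_m)\},$$ where $K_1+\cdots+K_m$ is the Minkowski sum. (This $m$-fold set is defined as a whole, not by iterating the two-body operation.) *)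

theory Defs
  imports "HOL-Analysis.Analysis"
begin

definition convex_body :: "(real ^ 'n) set \<Rightarrow> bool" where
  "convex_body K \<longleftrightarrow> compact K \<and> convex K \<and> interior K \<noteq> {}"

definition fconv :: "(real ^ 'n \<Rightarrow> real) \<Rightarrow> (real ^ 'n \<Rightarrow> real) \<Rightarrow> real ^ 'n \<Rightarrow> real" where
  "fconv f g = (\<lambda>x. LINT y|lborel. f y * g (x - y))"

text \<open>
  The iterated convolution of \<open>f 1, \<dots>, f m\<close>, for \<open>m \<ge> 1\<close>.  There is no function that is a unit
  for convolution, so the value at \<open>m = 0\<close> is arbitrary.
\<close>
fun fconv_upto :: "(nat \<Rightarrow> real ^ 'n \<Rightarrow> real) \<Rightarrow> nat \<Rightarrow> real ^ 'n \<Rightarrow> real" where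
  "fconv_upto f 0 = (\<lambda>x. 0)"
| "fconv_upto f (Suc 0) = f 1"
| "fconv_upto f (Suc (Suc k)) = fconv (fconv_upto f (Suc k)) (f (Suc (Suc k)))"

definition body_conv :: "(nat \<Rightarrow> (real ^ 'n) set) \<Rightarrow> nat \<Rightarrow> real ^ 'n \<Rightarrow> real" where
  "body_conv K m = fconv_upto (\<lambda>i. indicator (K i)) m"

definition max_conv :: "(nat \<Rightarrow> (real ^ 'n) set) \<Rightarrow> nat \<Rightarrow> real" where
  "max_conv K m = (GREATEST v. v \<in> range (body_conv K m))"

text \<open>The sum of sets below is the Minkowski sum, from \<open>Set_Algebras\<close>.\<close>
definition theta_sum :: "real \<Rightarrow> (nat \<Rightarrow> (real ^ 'n) set) \<Rightarrow> nat \<Rightarrow> (real ^ 'n) set" where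
  "theta_sum \<theta> K m = {x \<in> (\<Sum>i = 1..m. K i). body_conv K m x \<ge> \<theta> * max_conv K m}"

end

theory Submission
  imports Defs
begin

text \<open>
  Let \<open>f\<close> be the convolution of the indicators, \<open>S\<close> the Minkowski sum of the bodies and \<open>x\<close> a point
  where \<open>f\<close> is maximal.  For \<open>z \<in> S\<close> and \<open>0 \<le> c \<le> 1\<close>, the fibre over \<open>(1 - c) z + c x\<close> of the addition
  map on the product of the bodies contains a copy of the fibre over \<open>x\<close> scaled by \<open>c\<close>, hence
  \<open>f ((1 - c) z + c x) \<ge> c ^ ((m - 1) n) * f x\<close>.  With \<open>c = \<theta> powr (1 / ((m - 1) n))\<close> this says that the
  \<open>\<theta>\<close>-sum contains \<open>(1 - c) S + c x\<close>, and the volume of \<open>S\<close> is bounded below by the Brunn-Minkowski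
  inequality.  The latter is proved by the Hadwiger-Ohmann argument: induction on the number of
  boxes for finite unions of disjoint boxes, followed by approximation from inside.
\<close>

section \<open>The Brunn-Minkowski inequality\<close>

text \<open>Open boxes make disjointness literal and are preserved by cutting with open coordinate
  half-spaces. Being nonempty, every member has positive measure.\<close>

definition box_family :: "'a::euclidean_space set set \<Rightarrow> bool" where
  "box_family D \<longleftrightarrow> finite D \<and> disjoint D \<and> (\<forall>k\<in>D. k \<noteq> {} \<and> (\<exists>a b. k = box a b))"

text \<open>Empty traces are dropped so that the cut of a box family is again a box family and
  members missing \<open>H\<close> no longer count.\<close>

definition cut_family :: "'a set \<Rightarrow> 'a set set \<Rightarrow> 'a set set" where
  "cut_family H D = (\<lambda>k. k \<inter> H) ` D - {{}}"

lemma Union_cut_family: "\<Union>(cut_family H D) = \<Union>D \<inter> H"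
  by (auto simp: cut_family_def)

lemma card_cut_family_le: "finite D \<Longrightarrow> card (cut_family H D) \<le> card D"
  unfolding cut_family_def by (meson card_Diff1_le card_image_le le_trans finite_imageI)

text \<open>The member that misses \<open>H\<close> leaves only the empty trace, which is removed.
  This strict drop drives the induction on the number of boxes.\<close>

lemma card_cut_family_less:
  assumes "finite D" "k \<in> D" "k \<inter> H = {}"
  shows "card (cut_family H D) < card D"
proof -
  have "cut_family H D \<subseteq> (\<lambda>k. k \<inter> H) ` (D - {k})"
    using assms by (auto simp: cut_family_def)
  then have "card (cut_family H D) \<le> card (D - {k})"
    by (meson assms(1) card_image_le card_mono finite_Diff finite_imageI le_trans)
  also have "\<dots> < card D"
    using assms by (meson card_Diff1_less)
  finally show ?thesis .
qed

text \<open>A half-space orthogonal to a basis vector affects at most one bound of a box. The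
  resulting box may be empty.\<close>

lemma box_Int_halfspace_lt:
  fixes a b i :: "'a::euclidean_space"
  assumes "i \<in> Basis"
  shows "\<exists>a' b'. box a b \<inter> {x. x \<bullet> i < c} = box a' b'"
proof -
  have "box a b \<inter> {x. x \<bullet> i < c}
      = box a (\<Sum>j\<in>Basis. (if j = i then min (b \<bullet> i) c else b \<bullet> j) *\<^sub>R j)"
    using assms by (fastforce simp: mem_box split: if_splits)
  then show ?thesis by blast
qed

lemma box_Int_halfspace_gt:
  fixes a b i :: "'a::euclidean_space"
  assumes "i \<in> Basis"
  shows "\<exists>a' b'. box a b \<inter> {x. x \<bullet> i > c} = box a' b'"
proof -
  have "box a b \<inter> {x. x \<bullet> i > c}
      = box (\<Sum>j\<in>Basis. (if j = i then max (a \<bullet> i) c else a \<bullet> j) *\<^sub>R j) b"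
    using assms by (fastforce simp: mem_box split: if_splits)
  then show ?thesis by blast
qed

lemma box_family_cut:
  assumes "box_family D" "\<And>a b. \<exists>a' b'. box a b \<inter> H = box a' b'"
  shows "box_family (cut_family H D)"
proof -
  have "disjoint (cut_family H D)"
    using assms(1) unfolding box_family_def cut_family_def disjoint_def by fastforce
  moreover have "\<exists>a b. k \<inter> H = box a b" if "k \<in> D" for k
    using that assms unfolding box_family_def by metis
  ultimately show ?thesis
    using assms(1) by (auto simp: box_family_def cut_family_def)
qed

lemma open_box_family: "box_family D \<Longrightarrow> open (\<Union>D)"
  by (auto simp: box_family_def intro!: open_Union)

lemma bounded_box_family: "box_family D \<Longrightarrow> bounded (\<Union>D)"
  by (auto simp: box_family_def intro!: bounded_Union)

lemma measure_open_pos: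
  fixes S :: "'a::euclidean_space set"
  assumes "open S" "bounded S" "S \<noteq> {}"
  shows "0 < measure lebesgue S"
  using assms open_not_negligible[of S] lmeasurable_open[of S]
  by (metis bounded_set_imp_lmeasurable fmeasurableD negligible_iff_measure zero_less_measure_iff)

lemma measure_box_family_pos: "box_family D \<Longrightarrow> D \<noteq> {} \<Longrightarrow> 0 < measure lebesgue (\<Union>D)"
  by (intro measure_open_pos open_box_family bounded_box_family) (auto simp: box_family_def)

section \<open>Minkowski sums and the case of two boxes\<close>

lemma open_set_plus:
  fixes S T :: "'a::real_normed_vector set"
  assumes "open S" shows "open (S + T)"
proof -
  have "S + T = (\<Union>x\<in>S. \<Union>y\<in>T. {x + y})" by (auto simp: set_plus_def)
  then show ?thesis using open_sums[of S T] assms by simp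
qed

lemma compact_set_plus:
  fixes S T :: "'a::real_normed_vector set"
  assumes "compact S" "compact T" shows "compact (S + T)"
proof -
  have "S + T = (\<Union>x\<in>S. \<Union>y\<in>T. {x + y})" by (auto simp: set_plus_def)
  then show ?thesis using compact_sums'[of S T] assms by simp
qed

lemma bounded_set_plus:
  fixes S T :: "'a::real_normed_vector set"
  assumes "bounded S" "bounded T" shows "bounded (S + T)"
proof -
  have "S + T = (\<Union>x\<in>S. \<Union>y\<in>T. {x + y})" by (auto simp: set_plus_def)
  then show ?thesis using bounded_sums[of S T] assms by simp
qed

lemma box_plus_box:
  fixes a b c d :: "'a::euclidean_space"
  assumes "box a b \<noteq> {}" "box c d \<noteq> {}"
  shows "box (a + c) (b + d) \<subseteq> box a b + box c d"
proof
  fix x assume x: "x \<in> box (a + c) (b + d)"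
  \<comment> \<open>\<open>r i\<close> is the relative position of \<open>x\<close> along the i-th
    edge of the large box. Taking that same position in both small boxes splits \<open>x\<close>
    into \<open>y\<close> and \<open>x - y\<close>.\<close>
  define r where "r i = (x \<bullet> i - a \<bullet> i - c \<bullet> i) / ((b \<bullet> i - a \<bullet> i) + (d \<bullet> i - c \<bullet> i))" for i
  define y where "y = (\<Sum>i\<in>Basis. (a \<bullet> i + r i * (b \<bullet> i - a \<bullet> i)) *\<^sub>R i)"
  have pos: "a \<bullet> i < b \<bullet> i" "c \<bullet> i < d \<bullet> i" if "i \<in> Basis" for i
    using assms that by (auto simp: box_ne_empty)
  have r: "0 < r i" "r i < 1" if "i \<in> Basis" for i
    using x pos[OF that] that unfolding r_def by (auto simp: mem_box inner_simps)
  have yi: "y \<bullet> i = a \<bullet> i + r i * (b \<bullet> i - a \<bullet> i)" if "i \<in> Basis" for i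
    using that by (simp add: y_def)
  have rm: "x \<bullet> i - y \<bullet> i = c \<bullet> i + r i * (d \<bullet> i - c \<bullet> i)" if "i \<in> Basis" for i
  proof -
    have "r i * ((b \<bullet> i - a \<bullet> i) + (d \<bullet> i - c \<bullet> i)) = x \<bullet> i - a \<bullet> i - c \<bullet> i"
      using pos[OF that] by (simp add: r_def)
    then show ?thesis using yi[OF that] by (simp add: algebra_simps)
  qed
  have between: "l < l + s * (u - l)" "l + s * (u - l) < u" if "0 < s" "s < 1" "l < u" for l u s :: real
  proof -
    show "l < l + s * (u - l)" using that by simp
    have "s * (u - l) < 1 * (u - l)" using that by (intro mult_strict_right_mono) auto
    then show "l + s * (u - l) < u" by simp
  qed
  have "y \<in> box a b"
    unfolding mem_box using between[OF r pos(1)] by (simp add: yi)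
  moreover have "x - y \<in> box c d"
    unfolding mem_box using between[OF r pos(2)] by (simp add: rm inner_diff_left)
  ultimately show "x \<in> box a b + box c d"
    by (metis add.commute diff_add_cancel set_plus_intro)
qed

text \<open>Divide by the root of the right-hand side and apply the AM-GM inequality to both summands.\<close>
lemma minkowski_prod_root:
  fixes a b :: "'i \<Rightarrow> real"
  assumes "finite I" "I \<noteq> {}" and pos: "\<And>i. i \<in> I \<Longrightarrow> 0 < a i" "\<And>i. i \<in> I \<Longrightarrow> 0 < b i"
  shows "(root (card I) (\<Prod>i\<in>I. a i) + root (card I) (\<Prod>i\<in>I. b i)) ^ card I \<le> (\<Prod>i\<in>I. a i + b i)"
proof -
  let ?n = "card I"
  let ?P = "\<Prod>i\<in>I. a i + b i"
  have n: "?n > 0" using assms by (simp add: card_gt_0_iff)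
  have P: "?P > 0" using pos by (intro prod_pos) (simp add: add_pos_pos)
  have amgm: "root ?n (\<Prod>i\<in>I. x i / (a i + b i)) \<le> (\<Sum>i\<in>I. x i / (a i + b i) / ?n)"
    if "\<And>i. i \<in> I \<Longrightarrow> 0 < x i" for x
  proof -
    have nn: "x i / (a i + b i) \<ge> 0" if "i \<in> I" for i
      using pos[OF that] \<open>\<And>i. i \<in> I \<Longrightarrow> 0 < x i\<close>[OF that] by simp
    show ?thesis
      using arith_geom_mean[of I "\<lambda>i. x i / (a i + b i)", OF assms(1,2) nn] n nn
      by (simp add: root_powr_inverse prod_nonneg)
  qed
  have "root ?n (\<Prod>i\<in>I. a i) / root ?n ?P + root ?n (\<Prod>i\<in>I. b i) / root ?n ?P
      = root ?n (\<Prod>i\<in>I. a i / (a i + b i)) + root ?n (\<Prod>i\<in>I. b i / (a i + b i))"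
    by (simp add: prod_dividef real_root_divide)
  also have "\<dots> \<le> (\<Sum>i\<in>I. a i / (a i + b i) / ?n) + (\<Sum>i\<in>I. b i / (a i + b i) / ?n)"
    using amgm[OF pos(1)] amgm[OF pos(2)] by (rule add_mono)
  also have "\<dots> = (\<Sum>i\<in>I. 1 / ?n)"
  proof -
    have "a i / (a i + b i) / ?n + b i / (a i + b i) / ?n = 1 / ?n" if "i \<in> I" for i
      using add_pos_pos[OF pos(1)[OF that] pos(2)[OF that]]
      by (simp flip: add_divide_distrib)
    then show ?thesis by (simp flip: sum.distrib)
  qed
  also have "\<dots> = 1" using n by simp
  finally have "(root ?n (\<Prod>i\<in>I. a i) + root ?n (\<Prod>i\<in>I. b i)) / root ?n ?P \<le> 1"
    by (simp add: add_divide_distrib)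
  then have le: "root ?n (\<Prod>i\<in>I. a i) + root ?n (\<Prod>i\<in>I. b i) \<le> root ?n ?P"
    using P n by (simp add: divide_le_eq)
  have "0 \<le> root ?n (\<Prod>i\<in>I. a i) + root ?n (\<Prod>i\<in>I. b i)"
    using pos n by (intro add_nonneg_nonneg real_root_ge_zero prod_nonneg) (auto intro: less_imp_le)
  from power_mono[OF le this, of ?n] show ?thesis
    using P n by (simp add: real_root_pow_pos2)
qed

lemma measure_box:
  fixes a b :: "'a::euclidean_space"
  assumes "box a b \<noteq> {}"
  shows "measure lebesgue (box a b) = (\<Prod>i\<in>Basis. b \<bullet> i - a \<bullet> i)"
  using assms by (simp add: box_ne_empty inner_diff_left less_imp_le)

text \<open>The edges of \<open>box (a + c) (b + d)\<close> are sums of edges, so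
  \<open>minkowski_prod_root\<close> applies. The inequality is kept raised to the power
  \<open>DIM('a)\<close> because in this form both sides add over the two halves of a cut.\<close>

lemma brunn_minkowski_box:
  fixes a b c d :: "'a::euclidean_space"
  assumes ne: "box a b \<noteq> {}" "box c d \<noteq> {}"
  shows "(root DIM('a) (measure lebesgue (box a b)) + root DIM('a) (measure lebesgue (box c d))) ^ DIM('a)
      \<le> measure lebesgue (box a b + box c d)"
proof -
  have pos: "a \<bullet> i < b \<bullet> i" "c \<bullet> i < d \<bullet> i" if "i \<in> Basis" for i
    using ne that by (auto simp: box_ne_empty)
  have "box (a + c) (b + d) \<noteq> {}"
    using pos by (auto simp: box_ne_empty inner_add_left intro: add_strict_mono)
  note [simp] = measure_box[OF this] measure_box[OF ne(1)] measure_box[OF ne(2)]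
  have "(root DIM('a) (measure lebesgue (box a b)) + root DIM('a) (measure lebesgue (box c d))) ^ DIM('a)
      \<le> (\<Prod>i\<in>Basis. (b \<bullet> i - a \<bullet> i) + (d \<bullet> i - c \<bullet> i))"
    using minkowski_prod_root[of "Basis::'a set" "\<lambda>i. b \<bullet> i - a \<bullet> i" "\<lambda>i. d \<bullet> i - c \<bullet> i"] pos
    by simp
  also have "\<dots> = measure lebesgue (box (a + c) (b + d))"
    by (simp add: inner_add_left algebra_simps)
  also have "\<dots> \<le> measure lebesgue (box a b + box c d)"
    by (intro measure_mono_fmeasurable box_plus_box ne lmeasurable_open bounded_set_plus open_set_plus) auto
  finally show ?thesis .
qed

section \<open>Cutting open sets in a prescribed proportion\<close>

text \<open>The hyperplane missed by the two open half-spaces is a null set.\<close>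

lemma measure_Int_halfspaces:
  fixes S :: "'a::euclidean_space set"
  assumes "open S" "bounded S" "i \<in> Basis"
  shows "measure lebesgue S = measure lebesgue (S \<inter> {x. x \<bullet> i < c}) + measure lebesgue (S \<inter> {x. x \<bullet> i > c})"
proof -
  have o: "open {x::'a. x \<bullet> i < c}" "open {x::'a. x \<bullet> i > c}"
    by (auto simp: open_halfspace_component_lt open_halfspace_component_gt)
  have m: "S \<inter> {x. x \<bullet> i < c} \<in> lmeasurable" "S \<inter> {x. x \<bullet> i > c} \<in> lmeasurable"
    using o assms by (auto intro!: lmeasurable_open)
  have "negligible {x. x \<bullet> i = c}" using negligible_standard_hyperplane[OF assms(3), of c] .
  then have "negligible (S - (S \<inter> {x. x \<bullet> i < c} \<union> S \<inter> {x. x \<bullet> i > c}) \<union> (S \<inter> {x. x \<bullet> i < c} \<union> S \<inter> {x. x \<bullet> i > c} - S))"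
    by (rule negligible_subset) auto
  then have "measure lebesgue (S \<inter> {x. x \<bullet> i < c} \<union> S \<inter> {x. x \<bullet> i > c}) = measure lebesgue S"
    using assms by (intro measure_negligible_symdiff) (auto intro: lmeasurable_open)
  moreover have "measure lebesgue (S \<inter> {x. x \<bullet> i < c} \<union> S \<inter> {x. x \<bullet> i > c}) =
     measure lebesgue (S \<inter> {x. x \<bullet> i < c}) + measure lebesgue (S \<inter> {x. x \<bullet> i > c})"
    using m by (intro measure_Un_AE) (auto simp: fmeasurable_def)
  ultimately show ?thesis by simp
qed

text \<open>Dominated convergence: when the cuts \<open>u n\<close> tend to \<open>c\<close>, the
  indicators are eventually constant at every point off the null hyperplane
  \<open>x \<bullet> i = c\<close>, and the indicator of \<open>S\<close> dominates them.\<close>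

lemma continuous_measure_halfspace:
  fixes S :: "'a::euclidean_space set"
  assumes S: "S \<in> lmeasurable" and i: "i \<in> Basis"
  shows "isCont (\<lambda>c. measure lebesgue (S \<inter> {x. x \<bullet> i < c})) c"
proof (rule continuous_at_sequentiallyI)
  fix u assume u: "u \<longlonglongrightarrow> c"
  have H: "{x::'a. x \<bullet> i < r} \<in> sets lebesgue" for r
    by (intro sets_completionI_sets) (simp add: borel_open open_halfspace_component_lt)
  have "(\<lambda>n. LINT x|lebesgue. indicat_real (S \<inter> {x. x \<bullet> i < u n}) x)
      \<longlonglongrightarrow> (LINT x|lebesgue. indicat_real (S \<inter> {x. x \<bullet> i < c}) x)"
  proof (rule integral_dominated_convergence[where w="indicator S"])
    show "integrable lebesgue (indicat_real S)"
      using S by (intro integrable_real_indicator) (auto simp: fmeasurable_def)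
    show "AE x in lebesgue. (\<lambda>n. indicat_real (S \<inter> {x. x \<bullet> i < u n}) x) \<longlonglongrightarrow> indicat_real (S \<inter> {x. x \<bullet> i < c}) x"
    proof (rule AE_I')
      show "{x. x \<bullet> i = c} \<in> null_sets lebesgue"
        using negligible_standard_hyperplane[OF i, of c] by (simp add: negligible_iff_null_sets)
      have "(\<lambda>n. indicat_real (S \<inter> {x. x \<bullet> i < u n}) x) \<longlonglongrightarrow> indicat_real (S \<inter> {x. x \<bullet> i < c}) x"
        if "x \<bullet> i \<noteq> c" for x
      proof (rule tendsto_eventually)
        have "\<forall>\<^sub>F n in sequentially. (x \<bullet> i < u n) = (x \<bullet> i < c)"
        proof (cases "x \<bullet> i < c")
          case True
          then show ?thesis using order_tendstoD(1)[OF u True] by (auto elim: eventually_mono)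
        next
          case False
          then have "c < x \<bullet> i" using that by simp
          from order_tendstoD(2)[OF u this] show ?thesis by (rule eventually_mono) (use \<open>c < x \<bullet> i\<close> in auto)
        qed
        then show "\<forall>\<^sub>F n in sequentially. indicat_real (S \<inter> {x. x \<bullet> i < u n}) x = indicat_real (S \<inter> {x. x \<bullet> i < c}) x"
          by (rule eventually_mono) (auto simp: indicator_def)
      qed
      then show "{x \<in> space lebesgue. \<not> (\<lambda>n. indicat_real (S \<inter> {x. x \<bullet> i < u n}) x) \<longlonglongrightarrow> indicat_real (S \<inter> {x. x \<bullet> i < c}) x} \<subseteq> {x. x \<bullet> i = c}"
        by blast
    qed
    have meas: "S \<inter> {x. x \<bullet> i < r} \<in> sets lebesgue" for r
      using S H by blast
    show "indicat_real (S \<inter> {x. x \<bullet> i < c}) \<in> borel_measurable lebesgue"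
      "indicat_real (S \<inter> {x. x \<bullet> i < u n}) \<in> borel_measurable lebesgue" for n
      by (rule borel_measurable_indicator[OF meas])+
    show "AE x in lebesgue. norm (indicat_real (S \<inter> {x. x \<bullet> i < u n}) x) \<le> indicat_real S x" for n
      by (simp add: indicator_def)
  qed
  then show "(\<lambda>n. measure lebesgue (S \<inter> {x. x \<bullet> i < u n})) \<longlonglongrightarrow> measure lebesgue (S \<inter> {x. x \<bullet> i < c})"
    by simp
qed

text \<open>Intermediate value theorem: as the hyperplane sweeps across the bounded set, the measure
  of the part cut off runs continuously from 0 to the whole.\<close>

lemma halfspace_proportion:
  fixes S :: "'a::euclidean_space set"
  assumes S: "open S" "bounded S" and i: "i \<in> Basis" and t: "0 \<le> t" "t \<le> 1"
  obtains c where "measure lebesgue (S \<inter> {x. x \<bullet> i < c}) = t * measure lebesgue S"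
proof -
  obtain B where B: "\<And>x. x \<in> S \<Longrightarrow> norm x < B" "B > 0" using S(2) by (auto simp: bounded_pos_less)
  have xi: "\<bar>x \<bullet> i\<bar> < B" if "x \<in> S" for x
    using Basis_le_norm[OF i, of x] B(1)[OF that] by linarith
  have "S \<inter> {x. x \<bullet> i < - B} = {}" "S \<inter> {x. x \<bullet> i < B} = S"
    using xi by (fastforce simp: abs_less_iff)+
  then have "\<exists>c. -B \<le> c \<and> c \<le> B \<and> measure lebesgue (S \<inter> {x. x \<bullet> i < c}) = t * measure lebesgue S"
    using t B continuous_measure_halfspace[OF lmeasurable_open[OF S(2,1)] i] 
    by (intro IVT) (auto simp: mult_left_le_one_le)
  then show ?thesis using that by blast
qed

text \<open>The Brunn-Minkowski lower bound is homogeneous of degree one in the pair of volumes.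
  Hence cutting both sets in the ratio t : 1 - t splits the bound in that ratio.\<close>

lemma root_scale_sum_power:
  assumes "n > 0" "0 \<le> t"
  shows "(root n (t * x) + root n (t * y)) ^ n = t * (root n x + root n y) ^ n"
proof -
  have "root n (t * x) + root n (t * y) = root n t * (root n x + root n y)"
    by (simp add: real_root_mult distrib_left)
  then show ?thesis using assms by (simp add: power_mult_distrib real_root_pow_pos2)
qed

section \<open>Induction on the number of boxes\<close>

text \<open>Disjoint nonempty boxes have disjoint projections to some axis, and the upper end of the
  lower projection serves as \<open>c\<close>. The boxes are quantified anew because either of the
  two may be the lower one.\<close>

lemma box_family_separate:
  fixes D :: "'a::euclidean_space set set"
  assumes D: "box_family D" and kl: "k \<in> D" "l \<in> D" "k \<noteq> l"
  shows "\<exists>i\<in>Basis. \<exists>c. \<exists>k'\<in>D. \<exists>l'\<in>D. k' \<subseteq> {x. x \<bullet> i < c} \<and> l' \<subseteq> {x. x \<bullet> i > c}"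
proof -
  obtain a b where k: "k = box a b" "box a b \<noteq> {}" using D kl by (metis box_family_def)
  obtain a' b' where l: "l = box a' b'" "box a' b' \<noteq> {}" using D kl by (metis box_family_def)
  have "k \<inter> l = {}" using D kl by (auto simp: box_family_def disjoint_def)
  then obtain i where i: "i \<in> Basis" "b \<bullet> i \<le> a \<bullet> i \<or> b' \<bullet> i \<le> a' \<bullet> i \<or> b \<bullet> i \<le> a' \<bullet> i \<or> b' \<bullet> i \<le> a \<bullet> i"
    unfolding k(1) l(1) disjoint_interval(4) by blast
  have "a \<bullet> i < b \<bullet> i" "a' \<bullet> i < b' \<bullet> i"
    using k(2) l(2) i(1) by (auto simp: box_ne_empty)
  then consider "b \<bullet> i \<le> a' \<bullet> i" | "b' \<bullet> i \<le> a \<bullet> i" using i(2) by linarith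
  then show ?thesis
  proof cases
    case 1
    then have "k \<subseteq> {x. x \<bullet> i < b \<bullet> i}" "l \<subseteq> {x. x \<bullet> i > b \<bullet> i}"
      using i(1) by (force simp: k(1) l(1) mem_box)+
    then show ?thesis using i(1) kl by blast
  next
    case 2
    then have "l \<subseteq> {x. x \<bullet> i < b' \<bullet> i}" "k \<subseteq> {x. x \<bullet> i > b' \<bullet> i}"
      using i(1) by (force simp: k(1) l(1) mem_box)+
    then show ?thesis using i(1) kl by blast
  qed
qed

text \<open>Cut \<open>D\<close> by a hyperplane that separates two of its boxes, and \<open>E\<close> by a parallel hyperplane in the
  same proportion: the sums of the two pairs of halves lie in complementary half-spaces.\<close>
lemma brunn_minkowski_split:
  fixes D E :: "'a::euclidean_space set set"
  assumes D: "box_family D" and E: "box_family E" "E \<noteq> {}"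
    and kl: "k \<in> D" "l \<in> D" "k \<noteq> l"
    and IH: "\<And>D' E' :: 'a set set. \<lbrakk>box_family D'; box_family E'; D' \<noteq> {}; E' \<noteq> {}; card D' < card D; card E' \<le> card E\<rbrakk> \<Longrightarrow>
      (root DIM('a) (measure lebesgue (\<Union>D')) + root DIM('a) (measure lebesgue (\<Union>E'))) ^ DIM('a)
      \<le> measure lebesgue (\<Union>D' + \<Union>E')"
  shows "(root DIM('a) (measure lebesgue (\<Union>D)) + root DIM('a) (measure lebesgue (\<Union>E))) ^ DIM('a)
      \<le> measure lebesgue (\<Union>D + \<Union>E)"
proof -
  let ?m = "measure lebesgue :: 'a set \<Rightarrow> real"
  let ?b = "\<lambda>x y. (root DIM('a) x + root DIM('a) y) ^ DIM('a)"
  obtain i c k' l' where i: "i \<in> Basis" and k': "k' \<in> D" "k' \<subseteq> {x. x \<bullet> i < c}"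
    and l': "l' \<in> D" "l' \<subseteq> {x. x \<bullet> i > c}"
    using box_family_separate[OF D kl] by blast
  let ?L = "\<lambda>c. {x::'a. x \<bullet> i < c}" and ?G = "\<lambda>c. {x::'a. x \<bullet> i > c}"
  have cutL: "box_family (cut_family (?L r) F)" and cutG: "box_family (cut_family (?G r) F)"
    if "box_family F" for r F
    by (rule box_family_cut[OF that box_Int_halfspace_lt[OF i]],
        rule box_family_cut[OF that box_Int_halfspace_gt[OF i]])
  have finD: "finite D" "finite E" and "k' \<noteq> {}" "l' \<noteq> {}"
    using D E k' l' by (auto simp: box_family_def)
  have neL: "cut_family (?L c) D \<noteq> {}"
    using k' \<open>k' \<noteq> {}\<close> Union_cut_family[of "?L c" D] by auto
  have neG: "cut_family (?G c) D \<noteq> {}"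
    using l' \<open>l' \<noteq> {}\<close> Union_cut_family[of "?G c" D] by auto
  \<comment> \<open>\<open>l'\<close> misses the lower half-space and \<open>k'\<close> the upper
    one, so both cuts of \<open>D\<close> lose a box. For \<open>E\<close> it suffices that the
    number of boxes does not grow.\<close>
  have cardL: "card (cut_family (?L c) D) < card D"
    using l' by (intro card_cut_family_less[OF finD(1) l'(1)]) force
  have cardG: "card (cut_family (?G c) D) < card D"
    using k' by (intro card_cut_family_less[OF finD(1) k'(1)]) force
  define A where "A = \<Union>D"
  define B where "B = \<Union>E"
  have A: "open A" "bounded A" "0 < ?m A"
    using D kl measure_box_family_pos[of D] by (auto simp: A_def open_box_family bounded_box_family)
  have B: "open B" "bounded B" "0 < ?m B"
    using E measure_box_family_pos[of E] by (auto simp: B_def open_box_family bounded_box_family)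
  define t where "t = ?m (A \<inter> ?L c) / ?m A"
  have AL: "?m (A \<inter> ?L c) = t * ?m A" using A by (simp add: t_def)
  have AG: "?m (A \<inter> ?G c) = (1 - t) * ?m A"
    using AL measure_Int_halfspaces[OF A(1,2) i, of c] by (simp add: algebra_simps)
  have "0 < ?m (A \<inter> ?L c)" "0 < ?m (A \<inter> ?G c)"
    using measure_box_family_pos[OF cutL[OF D] neL] measure_box_family_pos[OF cutG[OF D] neG]
    by (auto simp: A_def Union_cut_family)
  \<comment> \<open>As \<open>t\<close> is neither 0 nor 1, both parts of \<open>B\<close> will have
    positive measure, so the cuts of \<open>E\<close> are nonempty, as \<open>IH\<close>
    demands.\<close>
  then have t: "0 < t" "t < 1" using AL AG A by (auto simp: zero_less_mult_iff)
  obtain s where BL: "?m (B \<inter> ?L s) = t * ?m B"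
    using halfspace_proportion[OF B(1,2) i, of t] t by auto
  have BG: "?m (B \<inter> ?G s) = (1 - t) * ?m B"
    using BL measure_Int_halfspaces[OF B(1,2) i, of s] by (simp add: algebra_simps)
  have neEL: "cut_family (?L s) E \<noteq> {}"
    using BL B t Union_cut_family[of "?L s" E] by (auto simp: B_def)
  have neEG: "cut_family (?G s) E \<noteq> {}"
    using BG B t Union_cut_family[of "?G s" E] by (auto simp: B_def)
  have L: "?b (t * ?m A) (t * ?m B) \<le> ?m (A \<inter> ?L c + B \<inter> ?L s)"
    using IH[OF cutL[OF D, of c] cutL[OF E(1), of s] neL neEL cardL card_cut_family_le[OF finD(2), of "?L s"]]
    by (simp add: Union_cut_family flip: A_def B_def AL BL)
  have G: "?b ((1 - t) * ?m A) ((1 - t) * ?m B) \<le> ?m (A \<inter> ?G c + B \<inter> ?G s)"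
    using IH[OF cutG[OF D, of c] cutG[OF E(1), of s] neG neEG cardG card_cut_family_le[OF finD(2), of "?G s"]]
    by (simp add: Union_cut_family flip: A_def B_def AG BG)
  have lm: "A \<inter> ?L c + B \<inter> ?L s \<in> lmeasurable" "A \<inter> ?G c + B \<inter> ?G s \<in> lmeasurable" "A + B \<in> lmeasurable"
    using A B by (auto intro!: lmeasurable_open bounded_set_plus open_set_plus
        simp: open_halfspace_component_lt open_halfspace_component_gt)
  have disj: "(A \<inter> ?L c + B \<inter> ?L s) \<inter> (A \<inter> ?G c + B \<inter> ?G s) = {}"
  proof -
    have "A \<inter> ?L c + B \<inter> ?L s \<subseteq> ?L (c + s)" "A \<inter> ?G c + B \<inter> ?G s \<subseteq> ?G (c + s)"
      by (auto simp: set_plus_def inner_add_left)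
    then show ?thesis by fastforce
  qed
  have "?b (?m A) (?m B) = t * ?b (?m A) (?m B) + (1 - t) * ?b (?m A) (?m B)"
    by (simp add: algebra_simps)
  also have "\<dots> = ?b (t * ?m A) (t * ?m B) + ?b ((1 - t) * ?m A) ((1 - t) * ?m B)"
    using t by (simp only: root_scale_sum_power[OF DIM_positive])
  also have "\<dots> \<le> ?m (A \<inter> ?L c + B \<inter> ?L s) + ?m (A \<inter> ?G c + B \<inter> ?G s)"
    using L G by (rule add_mono)
  also have "\<dots> = ?m ((A \<inter> ?L c + B \<inter> ?L s) \<union> (A \<inter> ?G c + B \<inter> ?G s))"
    using lm disj by (intro measure_Un_AE[symmetric]) auto
  also have "\<dots> \<le> ?m (A + B)"
    using lm by (intro measure_mono_fmeasurable) (auto simp: set_plus_def)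
  finally show ?thesis by (simp add: A_def B_def)
qed

text \<open>Induction on the total number of boxes. A family with two distinct boxes is split, with
  the roles exchanged if it is the second one; otherwise two single boxes remain.\<close>

lemma brunn_minkowski_box_family:
  fixes D E :: "'a::euclidean_space set set"
  assumes "box_family D" "box_family E" "D \<noteq> {}" "E \<noteq> {}"
  shows "(root DIM('a) (measure lebesgue (\<Union>D)) + root DIM('a) (measure lebesgue (\<Union>E))) ^ DIM('a)
      \<le> measure lebesgue (\<Union>D + \<Union>E)"
  using assms
proof (induction "card D + card E" arbitrary: D E rule: less_induct)
  case less
  note prems = less.prems
  consider k l where "k \<in> D" "l \<in> D" "k \<noteq> l" | k l where "k \<in> E" "l \<in> E" "k \<noteq> l"
    | k l where "D = {k}" "E = {l}"
    using prems(3,4) by (metis is_singletonI' is_singleton_def)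
  then show ?case
  proof cases
    case 1
    show ?thesis
      by (rule brunn_minkowski_split[OF prems(1,2,4) 1]) (rule less.hyps, auto)
  next
    case 2
    have "(root DIM('a) (measure lebesgue (\<Union>E)) + root DIM('a) (measure lebesgue (\<Union>D))) ^ DIM('a)
      \<le> measure lebesgue (\<Union>E + \<Union>D)"
    proof (rule brunn_minkowski_split[OF prems(2,1,3) 2])
      fix D' E' :: "'a set set"
      assume "box_family D'" "box_family E'" "D' \<noteq> {}" "E' \<noteq> {}" "card D' < card E" "card E' \<le> card D"
      then show "(root DIM('a) (measure lebesgue (\<Union>D')) + root DIM('a) (measure lebesgue (\<Union>E'))) ^ DIM('a)
          \<le> measure lebesgue (\<Union>D' + \<Union>E')"
        using less.hyps[of E' D'] by (simp add: add.commute)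
    qed
    then show ?thesis by (simp add: add.commute)
  next
    case 3
    then obtain a b c d where "k = box a b" "l = box c d" "box a b \<noteq> {}" "box c d \<noteq> {}"
      using prems unfolding box_family_def by (metis insertI1)
    then show ?thesis using 3 brunn_minkowski_box[of a b c d] by simp
  qed
qed

section \<open>From boxes to open sets and convex bodies\<close>

text \<open>An open set is a countable union of closed boxes, finitely many of which exhaust its
  measure up to the error. These are subdivided without overlap, and passing to the interiors of the
  pieces loses only their null boundaries.\<close>

lemma open_approx_box_family:
  fixes S :: "'a::euclidean_space set"
  assumes "open S" "bounded S" "S \<noteq> {}" "e > 0"
  obtains D where "box_family D" "D \<noteq> {}" "\<Union>D \<subseteq> S" "measure lebesgue S - e < measure lebesgue (\<Union>D)"
proof -
  have S: "S \<in> lmeasurable" and pos: "0 < measure lebesgue S"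
    using assms lmeasurable_open measure_open_pos by blast+
  \<comment> \<open>Capping the error at the measure of \<open>S\<close> forces the approximation to
    have positive measure, hence \<open>D \<noteq> {}\<close>.\<close>
  define e' where "e' = min e (measure lebesgue S)"
  have e': "0 < e'" "e' \<le> e" "e' \<le> measure lebesgue S" using assms pos by (auto simp: e'_def)
  obtain \<D> where \<D>: "countable \<D>" "\<D> \<subseteq> Pow S" "\<And>X. X \<in> \<D> \<Longrightarrow> \<exists>a b. X = cbox a b" "\<Union>\<D> = S"
    using open_countable_Union_open_cbox[OF assms(1)] by metis
  obtain D' where D': "D' \<subseteq> \<D>" "finite D'" "measure lebesgue (\<Union>\<D>) - e' < measure lebesgue (\<Union>D')"
  proof (rule measure_countable_Union_approachable[OF \<D>(1) e'(1), of "measure lebesgue S"])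
    show "d \<in> lmeasurable" if "d \<in> \<D>" for d using \<D>(3)[OF that] by auto
    show "measure lebesgue (\<Union>D') \<le> measure lebesgue S" if "D' \<subseteq> \<D>" "finite D'" for D'
    proof (rule measure_mono_fmeasurable[OF _ _ S])
      show "\<Union>D' \<subseteq> S" using that \<D> by blast
      show "\<Union>D' \<in> sets lebesgue"
        using that \<D>(3) by (intro sets.finite_Union) fastforce+
    qed
  qed blast
  obtain p where p: "p division_of \<Union>D'"
    using elementary_unions_intervals[OF D'(2)] \<D>(3) D'(1) by (metis subsetD)
  \<comment> \<open>A degenerate piece of the division has empty interior; removing the empty set
    discards it.\<close>
  define D where "D = interior ` p - {{}}"
  have fin: "finite p" using p by auto
  have box: "\<exists>a b. k = cbox a b" if "k \<in> p" for k using division_ofD(4)[OF p that] .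
  have dis: "interior k \<inter> interior l = {}" if "k \<in> p" "l \<in> p" "k \<noteq> l" for k l
    using division_ofD(5)[OF p that] .
  have "box_family D"
    unfolding box_family_def
  proof (intro conjI ballI)
    show "finite D" using fin by (simp add: D_def)
    show "disjoint D" using dis by (auto simp: D_def disjoint_def)
    fix k assume "k \<in> D"
    then show "k \<noteq> {}" "\<exists>a b. k = box a b" using box by (force simp: D_def)+
  qed
  moreover have sub: "\<Union>D \<subseteq> \<Union>p"
    using interior_subset by (fastforce simp: D_def)
  moreover have up: "\<Union>p = \<Union>D'" using division_ofD(6)[OF p] .
  moreover have "measure lebesgue (\<Union>D) = measure lebesgue (\<Union>p)"
  proof (rule measure_negligible_symdiff)
    show "\<Union>p \<in> lmeasurable" using p up lmeasurable_division by metis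
    have "negligible (\<Union>k\<in>p. frontier k)"
      using fin box by (intro negligible_Union) (auto intro!: negligible_convex_frontier, metis convex_box(1))
    then show "negligible (\<Union>p - \<Union>D \<union> (\<Union>D - \<Union>p))"
    proof (rule negligible_subset)
      have "x \<in> frontier k" if "x \<in> k" "k \<in> p" "x \<notin> \<Union>D" for x k
        using that closure_subset[of k] by (auto simp: D_def frontier_def)
      then show "\<Union>p - \<Union>D \<union> (\<Union>D - \<Union>p) \<subseteq> (\<Union>k\<in>p. frontier k)"
        using sub by blast
    qed
  qed
  moreover have "\<Union>D' \<subseteq> S" using D'(1) \<D>(4) by blast
  ultimately have *: "measure lebesgue S - e' < measure lebesgue (\<Union>D)" "\<Union>D \<subseteq> S" "box_family D"
    using D'(3) \<D>(4) by auto
  then have "D \<noteq> {}" using e'(3) by auto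
  then show ?thesis using that[of D] * e' by auto
qed

lemma brunn_minkowski_open:
  fixes S T :: "'a::euclidean_space set"
  assumes S: "open S" "bounded S" "S \<noteq> {}" and T: "open T" "bounded T" "T \<noteq> {}"
  shows "(root DIM('a) (measure lebesgue S) + root DIM('a) (measure lebesgue T)) ^ DIM('a)
      \<le> measure lebesgue (S + T)"
proof -
  let ?b = "\<lambda>x y. (root DIM('a) x + root DIM('a) y) ^ DIM('a)"
  \<comment> \<open>The side conditions keep the differences nonnegative, as monotonicity of the
    power requires. They hold for large \<open>n\<close> because nonempty open sets have positive
    measure.\<close>
  have approx: "?b (measure lebesgue S - 1 / Suc n) (measure lebesgue T - 1 / Suc n) \<le> measure lebesgue (S + T)"
    if "1 / Suc n < measure lebesgue S" "1 / Suc n < measure lebesgue T" for n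
  proof -
    obtain D where D: "box_family D" "D \<noteq> {}" "\<Union>D \<subseteq> S" "measure lebesgue S - 1 / Suc n < measure lebesgue (\<Union>D)"
      using open_approx_box_family[OF S, of "1 / Suc n"] by auto
    obtain E where E: "box_family E" "E \<noteq> {}" "\<Union>E \<subseteq> T" "measure lebesgue T - 1 / Suc n < measure lebesgue (\<Union>E)"
      using open_approx_box_family[OF T, of "1 / Suc n"] by auto
    have "?b (measure lebesgue S - 1 / Suc n) (measure lebesgue T - 1 / Suc n)
        \<le> ?b (measure lebesgue (\<Union>D)) (measure lebesgue (\<Union>E))"
      using D E that by (intro power_mono add_mono add_nonneg_nonneg) auto
    also have "\<dots> \<le> measure lebesgue (\<Union>D + \<Union>E)"
      by (rule brunn_minkowski_box_family[OF D(1) E(1) D(2) E(2)])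
    also have "\<dots> \<le> measure lebesgue (S + T)"
    proof (rule measure_mono_fmeasurable)
      show "\<Union>D + \<Union>E \<subseteq> S + T" using D E by (intro set_plus_mono2)
      show "\<Union>D + \<Union>E \<in> sets lebesgue"
        using open_set_plus[OF open_box_family[OF D(1)], of "\<Union>E"] by (intro sets_completionI_sets) simp
      show "S + T \<in> lmeasurable" using S T by (intro lmeasurable_open bounded_set_plus open_set_plus)
    qed
    finally show ?thesis .
  qed
  have lim: "(\<lambda>n. 1 / real (Suc n)) \<longlonglongrightarrow> 0"
    using lim_inverse_n' LIMSEQ_Suc by fastforce
  have "\<forall>\<^sub>F n in sequentially. 1 / Suc n < measure lebesgue S"
    "\<forall>\<^sub>F n in sequentially. 1 / Suc n < measure lebesgue T"
    using order_tendstoD(2)[OF lim] measure_open_pos[OF S] measure_open_pos[OF T] by auto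
  then have "\<forall>\<^sub>F n in sequentially. 1 / Suc n < measure lebesgue S \<and> 1 / Suc n < measure lebesgue T"
    by (rule eventually_conj)
  then have ev: "\<forall>\<^sub>F n in sequentially.
      ?b (measure lebesgue S - 1 / Suc n) (measure lebesgue T - 1 / Suc n) \<le> measure lebesgue (S + T)"
    by (rule eventually_mono) (use approx in blast)
  have "(\<lambda>n. ?b (measure lebesgue S - 1 / Suc n) (measure lebesgue T - 1 / Suc n))
      \<longlonglongrightarrow> ?b (measure lebesgue S - 0) (measure lebesgue T - 0)"
    by (intro tendsto_intros lim)
  from tendsto_upperbound[OF this ev] show ?thesis by simp
qed

text \<open>The boundary of a convex set is null, so the interiors carry the full volumes and the
  open case applies to them.\<close>

lemma brunn_minkowski_convex:
  fixes S T :: "'a::euclidean_space set"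
  assumes S: "compact S" "convex S" "interior S \<noteq> {}" and T: "compact T" "convex T" "interior T \<noteq> {}"
  shows "root DIM('a) (measure lebesgue S) + root DIM('a) (measure lebesgue T)
      \<le> root DIM('a) (measure lebesgue (S + T))"
proof -
  have eq: "measure lebesgue (interior S) = measure lebesgue S" "measure lebesgue (interior T) = measure lebesgue T"
    by (rule measure_interior[OF compact_imp_bounded negligible_convex_frontier], fact S T, fact S T)+
  have "(root DIM('a) (measure lebesgue S) + root DIM('a) (measure lebesgue T)) ^ DIM('a)
      \<le> measure lebesgue (interior S + interior T)"
    using brunn_minkowski_open[of "interior S" "interior T"] S T
    by (simp add: eq bounded_interior compact_imp_bounded)
  also have "\<dots> \<le> measure lebesgue (S + T)"
  proof (rule measure_mono_fmeasurable)
    show "interior S + interior T \<subseteq> S + T" by (intro set_plus_mono2 interior_subset)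
    show "interior S + interior T \<in> sets lebesgue"
      using open_set_plus[of "interior S" "interior T"] by (intro sets_completionI_sets) simp
    show "S + T \<in> lmeasurable" using S T by (intro lmeasurable_compact compact_set_plus)
  qed
  finally have "root DIM('a) ((root DIM('a) (measure lebesgue S) + root DIM('a) (measure lebesgue T)) ^ DIM('a))
      \<le> root DIM('a) (measure lebesgue (S + T))"
    by simp
  then show ?thesis by (simp add: real_root_power_cancel)
qed

section \<open>Convolutions of indicators of convex bodies\<close>

text \<open>The Jacobian is the source of one factor \<open>c ^ CARD('n)\<close> for each
  convolution in \<open>body_conv_scale\<close>.\<close>

lemma lborel_integral_affine:
  fixes f :: "'a::euclidean_space \<Rightarrow> real" and t :: 'a
  assumes [measurable]: "f \<in> borel_measurable borel" and c: "c \<noteq> 0"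
  shows "(LINT x|lborel. f x) = \<bar>c\<bar> ^ DIM('a) * (LINT x|lborel. f (t + c *\<^sub>R x))"
proof -
  have "(LINT x|lborel. f x) = (LINT x|density (distr lborel borel (\<lambda>x. t + c *\<^sub>R x)) (\<lambda>_. ennreal (\<bar>c\<bar>^DIM('a))). f x)"
    using lborel_affine[OF c, of t] by (simp add: ennreal_power)
  also have "\<dots> = \<bar>c\<bar> ^ DIM('a) * (LINT x|lborel. f (t + c *\<^sub>R x))"
    by (subst integral_density) (auto simp: integral_distr)
  finally show ?thesis .
qed

lemma convex_body_plus: "convex_body S \<Longrightarrow> convex_body T \<Longrightarrow> convex_body (S + T)"
  unfolding convex_body_def
proof (elim conjE, intro conjI)
  assume S: "compact S" "convex S" "interior S \<noteq> {}" and T: "compact T" "convex T" "interior T \<noteq> {}"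
  show "compact (S + T)" "convex (S + T)" using S T by (auto intro: compact_set_plus convex_set_plus)
  have "interior S + interior T \<subseteq> interior (S + T)"
    by (intro interior_maximal set_plus_mono2 interior_subset open_set_plus) auto
  then show "interior (S + T) \<noteq> {}" using S(3) T(3) by (auto simp: set_plus_def)
qed

text \<open>The index starts at \<open>Suc k\<close> because the empty Minkowski sum is
  \<open>{0}\<close>, which has empty interior.\<close>

lemma convex_body_sum:
  assumes "\<And>i. i \<in> {1..Suc k} \<Longrightarrow> convex_body (K i)"
  shows "convex_body (\<Sum>i = 1..Suc k. K i)"
  using assms
proof (induction k)
  case (Suc k)
  then have "convex_body ((\<Sum>i = 1..Suc k. K i) + K (Suc (Suc k)))"
    by (intro convex_body_plus Suc.IH) auto
  then show ?case by simp
qed simp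

lemma brunn_minkowski_sum:
  fixes K :: "nat \<Rightarrow> (real ^ 'n) set"
  assumes "\<And>i. i \<in> {1..Suc k} \<Longrightarrow> convex_body (K i)"
  shows "(\<Sum>i = 1..Suc k. root CARD('n) (measure lebesgue (K i)))
    \<le> root CARD('n) (measure lebesgue (\<Sum>i = 1..Suc k. K i))"
  using assms
proof (induction k)
  case (Suc k)
  have "convex_body (\<Sum>i = 1..Suc k. K i)"
    by (rule convex_body_sum) (use Suc.prems in auto)
  moreover have "convex_body (K (Suc (Suc k)))"
    using Suc.prems by auto
  ultimately have "root CARD('n) (measure lebesgue (\<Sum>i = 1..Suc k. K i)) + root CARD('n) (measure lebesgue (K (Suc (Suc k))))
    \<le> root CARD('n) (measure lebesgue ((\<Sum>i = 1..Suc k. K i) + K (Suc (Suc k))))"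
    using brunn_minkowski_convex[of "\<Sum>i = 1..Suc k. K i" "K (Suc (Suc k))"]
    unfolding convex_body_def by simp
  moreover have "(\<Sum>i = 1..Suc k. root CARD('n) (measure lebesgue (K i)))
      \<le> root CARD('n) (measure lebesgue (\<Sum>i = 1..Suc k. K i))"
    using Suc.prems by (intro Suc.IH) auto
  ultimately show ?case by simp
qed simp

section \<open>Regularity of the iterated convolution\<close>

text \<open>The integrand is bounded by \<open>C\<close> and vanishes off the compact set x -
  K.\<close>

lemma integrable_mult_indicator_reflect:
  fixes f :: "real ^ 'n \<Rightarrow> real"
  assumes [measurable]: "f \<in> borel_measurable borel" and f: "\<And>y. 0 \<le> f y" "\<And>y. f y \<le> C"
    and K: "compact K"
  shows "integrable lborel (\<lambda>y. f y * indicator K (x - y))"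
proof (rule Bochner_Integration.integrable_bound)
  have [measurable]: "K \<in> sets borel" using K by (simp add: borel_compact)
  have "compact ((\<lambda>y. x - y) ` K)"
    by (intro compact_continuous_image K continuous_intros)
  then have "integrable lborel (\<lambda>y. C * indicat_real ((\<lambda>y. x - y) ` K) y)"
    using emeasure_compact_finite[of "(\<lambda>y. x - y) ` K"]
    by (intro integrable_mult_right integrable_real_indicator) (auto simp: borel_compact)
  then show "integrable lborel (\<lambda>y. C * indicat_real ((\<lambda>y. x - y) ` K) y)" .
  show "(\<lambda>y. f y * indicator K (x - y)) \<in> borel_measurable lborel"
    by measurable
  have "y \<in> (\<lambda>y. x - y) ` K" if "x - y \<in> K" for y
    using that by (intro image_eqI[where x="x - y"]) auto
  moreover have "0 \<le> C" using f(1)[of 0] f(2)[of 0] by linarith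
  ultimately show "AE y in lborel. norm (f y * indicator K (x - y)) \<le> norm (C * indicat_real ((\<lambda>y. x - y) ` K) y)"
    using f by (intro AE_I2) (auto simp: indicator_def)
qed

text \<open>The indicator of \<open>x - K\<close> depends continuously on \<open>x\<close> off the boundary, which is a null set by convexity.\<close>
lemma continuous_on_fconv_indicator:
  fixes f :: "real ^ 'n \<Rightarrow> real"
  assumes [measurable]: "f \<in> borel_measurable borel" and f: "\<And>y. 0 \<le> f y" "\<And>y. f y \<le> C"
    and K: "compact K" "convex K"
  shows "continuous_on UNIV (fconv f (indicator K))"
  unfolding continuous_on_eq_continuous_at[OF open_UNIV]
proof (intro ballI continuous_at_sequentiallyI)
  fix x u assume u: "u \<longlonglongrightarrow> (x :: real ^ 'n)"
  have [measurable]: "K \<in> sets borel" using K by (simp add: borel_compact)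
  have C: "0 \<le> C" using f(1)[of 0] f(2)[of 0] by linarith
  \<comment> \<open>Since \<open>u\<close> and \<open>K\<close> are bounded, one ball contains all
    the sets u n - K; this yields a single dominating function.\<close>
  obtain U where U: "\<And>n. norm (u n) \<le> U"
    using convergent_imp_bounded[OF u] by (auto simp: bounded_iff)
  obtain R where R: "\<And>z. z \<in> K \<Longrightarrow> norm z \<le> R"
    using compact_imp_bounded[OF K(1)] by (auto simp: bounded_iff)
  show "(\<lambda>n. fconv f (indicator K) (u n)) \<longlonglongrightarrow> fconv f (indicator K) x"
    unfolding fconv_def
  proof (rule integral_dominated_convergence[where w="\<lambda>y. C * indicat_real (cball 0 (U + R)) y"])
    show "integrable lborel (\<lambda>y. C * indicat_real (cball 0 (U + R)) y)"
      by (intro integrable_mult_right integrable_real_indicator) (use emeasure_lborel_cball_finite[of 0 "U + R"] in auto)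
    show "AE y in lborel. norm (f y * indicat_real K (u n - y)) \<le> C * indicat_real (cball 0 (U + R)) y" for n
    proof (rule AE_I2)
      fix y
      have "norm y \<le> U + R" if "u n - y \<in> K"
        using norm_triangle_ineq4[of "u n" "u n - y"] R[OF that] U[of n] by simp
      then show "norm (f y * indicat_real K (u n - y)) \<le> C * indicat_real (cball 0 (U + R)) y"
        using f C by (auto simp: indicator_def)
    qed
    have "(\<lambda>n. f y * indicat_real K (u n - y)) \<longlonglongrightarrow> f y * indicat_real K (x - y)"
      if y: "x - y \<notin> frontier K" for y
    proof (intro tendsto_intros tendsto_eventually)
      have lim: "(\<lambda>n. u n - y) \<longlonglongrightarrow> x - y" by (intro tendsto_intros u)
      show "\<forall>\<^sub>F n in sequentially. indicat_real K (u n - y) = indicat_real K (x - y)"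
      proof (cases "x - y \<in> K")
        case True
        then have "x - y \<in> interior K" using y closure_subset[of K] by (auto simp: frontier_def)
        from topological_tendstoD[OF lim open_interior this] show ?thesis
          using True interior_subset[of K] by (auto elim!: eventually_mono simp: indicator_def)
      next
        case False
        have "open (- K)" using K by (simp add: compact_imp_closed open_Compl)
        from topological_tendstoD[OF lim this] show ?thesis
          using False by (auto elim!: eventually_mono simp: indicator_def)
      qed
    qed
    moreover have "(\<lambda>z. x - z) ` frontier K \<in> null_sets lborel"
    proof -
      have "negligible ((\<lambda>z. x - z) ` frontier K)"
        using negligible_convex_frontier[OF K(2)]
        by (intro negligible_differentiable_image_negligible) (auto intro!: derivative_intros)
      moreover have "compact ((\<lambda>z. x - z) ` frontier K)"
        using K by (intro compact_continuous_image continuous_intros compact_frontier)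
      ultimately show ?thesis
        by (simp add: negligible_iff_null_sets null_sets_completion_iff borel_compact)
    qed
    moreover have "y \<in> (\<lambda>z. x - z) ` frontier K" if "x - y \<in> frontier K" for y
      using that by (intro image_eqI[where x="x - y"]) auto
    ultimately show "AE y in lborel. (\<lambda>n. f y * indicat_real K (u n - y)) \<longlonglongrightarrow> f y * indicat_real K (x - y)"
      by (intro AE_I') blast+
  qed measurable
qed

lemma body_conv_1: "body_conv K (Suc 0) = indicator (K 1)"
  by (simp add: body_conv_def)

lemma body_conv_Suc: "body_conv K (Suc (Suc k)) = fconv (body_conv K (Suc k)) (indicator (K (Suc (Suc k))))"
  by (simp add: body_conv_def)

text \<open>The properties are proved together because they feed one another: measurability,
  nonnegativity and boundedness make the next convolution continuous. Continuity gives its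
  measurability and, on the compact Minkowski sum, a bound, which extends to the whole space because
  the function vanishes elsewhere.\<close>

lemma body_conv_bounded_measurable:
  fixes K :: "nat \<Rightarrow> (real ^ 'n) set"
  assumes "\<And>i. i \<in> {1..Suc k} \<Longrightarrow> convex_body (K i)"
  shows "body_conv K (Suc k) \<in> borel_measurable borel \<and> (\<forall>x. 0 \<le> body_conv K (Suc k) x)
    \<and> (\<exists>C. \<forall>x. body_conv K (Suc k) x \<le> C)
    \<and> (\<forall>x. x \<notin> (\<Sum>i = 1..Suc k. K i) \<longrightarrow> body_conv K (Suc k) x = 0)"
  using assms
proof (induction k)
  case 0
  then have "K 1 \<in> sets borel" by (simp add: convex_body_def borel_compact)
  moreover have "\<forall>x. indicat_real (K 1) x \<le> 1" by (simp add: indicator_def)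
  ultimately show ?case by (auto simp: body_conv_1 indicator_def)
next
  case (Suc k)
  define f where "f = body_conv K (Suc k)"
  define L where "L = K (Suc (Suc k))"
  have L: "compact L" "convex L" using Suc.prems by (auto simp: L_def convex_body_def)
  have f: "f \<in> borel_measurable borel" "\<And>x. 0 \<le> f x" "\<And>x. x \<notin> (\<Sum>i = 1..Suc k. K i) \<Longrightarrow> f x = 0"
    and "\<exists>C. \<forall>x. f x \<le> C"
    using Suc.IH Suc.prems by (auto simp: f_def simp del: sum.cl_ivl_Suc)
  then obtain C where C: "\<And>x. f x \<le> C" by blast
  have g: "body_conv K (Suc (Suc k)) = fconv f (indicator L)"
    by (simp add: f_def L_def body_conv_Suc)
  have cont: "continuous_on UNIV (fconv f (indicator L))"
    by (rule continuous_on_fconv_indicator[OF f(1,2) C L])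
  have zero: "fconv f (indicator L) x = 0" if "x \<notin> (\<Sum>i = 1..Suc k. K i) + L" for x
  proof -
    have "f y * indicator L (x - y) = 0" for y
      using that f(3)[of y] set_plus_intro[of y "\<Sum>i = 1..Suc k. K i" "x - y" L] by (auto simp: indicator_def)
    then show ?thesis unfolding fconv_def by (simp only: integral_zero)
  qed
  have nn: "0 \<le> fconv f (indicator L) x" for x
    using f(2) by (auto simp: fconv_def)
  have "compact ((\<Sum>i = 1..Suc k. K i) + L)"
    using convex_body_sum[of k K] Suc.prems L by (auto simp: convex_body_def intro!: compact_set_plus simp del: sum.cl_ivl_Suc)
  then have "bounded (fconv f (indicator L) ` ((\<Sum>i = 1..Suc k. K i) + L))"
    by (intro compact_imp_bounded compact_continuous_image continuous_on_subset[OF cont]) auto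
  then obtain M where "\<forall>v \<in> fconv f (indicator L) ` ((\<Sum>i = 1..Suc k. K i) + L). \<bar>v\<bar> \<le> M"
    unfolding bounded_real by blast
  then have M: "fconv f (indicator L) x \<le> M" if "x \<in> (\<Sum>i = 1..Suc k. K i) + L" for x
    using that by (meson abs_le_D1 imageI)
  have "fconv f (indicator L) x \<le> max M 0" for x
    using M[of x] zero[of x] by linarith
  moreover have "fconv f (indicator L) \<in> borel_measurable borel"
    using cont by (rule borel_measurable_continuous_onI)
  ultimately show ?case
    unfolding g using nn zero by (metis L_def sum.cl_ivl_Suc le_add1 not_less plus_1_eq_Suc)
qed

text \<open>At least two bodies are present: a single indicator is discontinuous, but one
  convolution already smooths it.\<close>

lemma continuous_on_body_conv:
  assumes "\<And>i. i \<in> {1..Suc (Suc k)} \<Longrightarrow> convex_body (K i)"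
  shows "continuous_on UNIV (body_conv K (Suc (Suc k)))"
proof -
  have "\<And>i. i \<in> {1..Suc k} \<Longrightarrow> convex_body (K i)" using assms by auto
  note * = body_conv_bounded_measurable[of k K, OF this]
  then obtain C where "\<And>x. body_conv K (Suc k) x \<le> C" by blast
  moreover have "convex_body (K (Suc (Suc k)))" using assms by auto
  ultimately show ?thesis
    unfolding body_conv_Suc using * by (intro continuous_on_fconv_indicator) (auto simp: convex_body_def)
qed

section \<open>The scaling estimate\<close>

text \<open>\<open>Suc k\<close> bodies involve \<open>k\<close> convolutions, whence the exponent.
  In the last convolution the variable is replaced by
  \<open>(1 - c) *\<^sub>R z' + c *\<^sub>R y\<close>: the induction hypothesis bounds the first
  factor, convexity of the last body the second, and the Jacobian gives the missing power of
  \<open>c\<close>.\<close>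

lemma body_conv_scale:
  fixes K :: "nat \<Rightarrow> (real ^ 'n) set"
  assumes "\<And>i. i \<in> {1..Suc k} \<Longrightarrow> convex_body (K i)" and c: "0 < c" "c \<le> 1"
    and "z \<in> (\<Sum>i = 1..Suc k. K i)"
  shows "c ^ (k * CARD('n)) * body_conv K (Suc k) x \<le> body_conv K (Suc k) ((1 - c) *\<^sub>R z + c *\<^sub>R x)"
  using assms(1,4)
proof (induction k arbitrary: z x)
  case 0
  then have "convex (K 1)" "z \<in> K 1" by (auto simp: convex_body_def)
  then show ?case using c by (auto simp: body_conv_1 indicator_def convex_alt)
next
  case (Suc k)
  define f where "f = body_conv K (Suc k)"
  define L where "L = K (Suc (Suc k))"
  have L: "compact L" "convex L" using Suc.prems by (auto simp: L_def convex_body_def)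
  then have [measurable]: "L \<in> sets borel" by (simp add: borel_compact)
  have prems: "\<And>i. i \<in> {1..Suc k} \<Longrightarrow> convex_body (K i)" using Suc.prems by auto
  note * = body_conv_bounded_measurable[of k K, OF prems]
  then obtain C where C: "\<And>x. f x \<le> C" unfolding f_def by blast
  have f[measurable]: "f \<in> borel_measurable borel" and nn: "\<And>x. 0 \<le> f x" using * by (auto simp: f_def)
  \<comment> \<open>\<open>z'\<close> is the point for the induction hypothesis, and
    \<open>a\<close> the point for convexity of \<open>L\<close>.\<close>
  obtain z' a where z: "z' \<in> (\<Sum>i = 1..Suc k. K i)" "a \<in> L" "z = z' + a"
    using Suc.prems(2) by (auto simp: L_def elim: set_plus_elim)
  let ?w = "(1 - c) *\<^sub>R z + c *\<^sub>R x"
  \<comment> \<open>One factor \<open>c ^ CARD('n)\<close> stays outside to become the Jacobian; the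
    rest is absorbed by the induction hypothesis.\<close>
  have "c ^ (Suc k * CARD('n)) * fconv f (indicator L) x
      = c ^ CARD('n) * (LINT y|lborel. c ^ (k * CARD('n)) * (f y * indicator L (x - y)))"
    by (simp add: fconv_def power_add)
  also have "\<dots> \<le> c ^ CARD('n) * (LINT y|lborel. f ((1 - c) *\<^sub>R z' + c *\<^sub>R y) * indicator L (?w - ((1 - c) *\<^sub>R z' + c *\<^sub>R y)))"
  proof (intro mult_left_mono integral_mono)
    show "integrable lborel (\<lambda>y. c ^ (k * CARD('n)) * (f y * indicator L (x - y)))"
      by (intro integrable_mult_right integrable_mult_indicator_reflect[OF f nn C L(1)])
    have "integrable lborel (\<lambda>y. f y * indicator L (?w - y))"
      by (rule integrable_mult_indicator_reflect[OF f nn C L(1)])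
    \<comment> \<open>Integrability is carried through the substitution by rewriting
      \<open>lborel\<close> as a scaled image of itself.\<close>
    then have "integrable (density (distr lborel borel (\<lambda>y. (1 - c) *\<^sub>R z' + c *\<^sub>R y)) (\<lambda>_. ennreal (\<bar>c\<bar> ^ DIM(real ^ 'n)))) (\<lambda>y. f y * indicator L (?w - y))"
      using lborel_affine[of c "(1 - c) *\<^sub>R z'"] c by (simp add: ennreal_power)
    then show "integrable lborel (\<lambda>y. f ((1 - c) *\<^sub>R z' + c *\<^sub>R y) * indicator L (?w - ((1 - c) *\<^sub>R z' + c *\<^sub>R y)))"
      using c by (simp add: integrable_density integrable_distr_eq)
    fix y
    have eq: "?w - ((1 - c) *\<^sub>R z' + c *\<^sub>R y) = (1 - c) *\<^sub>R a + c *\<^sub>R (x - y)"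
      unfolding z(3) by (simp add: algebra_simps)
    have "indicat_real L (x - y) \<le> indicator L (?w - ((1 - c) *\<^sub>R z' + c *\<^sub>R y))"
      unfolding eq using L(2) z(2) c by (auto simp: indicator_def convex_alt)
    moreover have "c ^ (k * CARD('n)) * f y \<le> f ((1 - c) *\<^sub>R z' + c *\<^sub>R y)"
      unfolding f_def by (rule Suc.IH[OF prems z(1)])
    ultimately show "c ^ (k * CARD('n)) * (f y * indicator L (x - y))
        \<le> f ((1 - c) *\<^sub>R z' + c *\<^sub>R y) * indicator L (?w - ((1 - c) *\<^sub>R z' + c *\<^sub>R y))"
      unfolding mult.assoc[symmetric] using nn by (intro mult_mono) auto
  qed (use c in auto)
  also have "\<dots> = fconv f (indicator L) ?w"
    unfolding fconv_def
    using lborel_integral_affine[of "\<lambda>y. f y * indicator L (?w - y)" c "(1 - c) *\<^sub>R z'"] c by simp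
  finally show ?case by (simp add: f_def L_def body_conv_Suc)
qed

section \<open>The maximum of the convolution and the volume bound\<close>

text \<open>The continuous convolution has a maximum on the compact Minkowski sum. It is global
  because the function is nonnegative and vanishes elsewhere, so \<open>GREATEST\<close> really
  denotes it.\<close>

lemma max_conv_attained:
  fixes K :: "nat \<Rightarrow> (real ^ 'n) set"
  assumes K: "\<And>i. i \<in> {1..Suc (Suc k)} \<Longrightarrow> convex_body (K i)"
  obtains x where "x \<in> (\<Sum>i = 1..Suc (Suc k). K i)" "max_conv K (Suc (Suc k)) = body_conv K (Suc (Suc k)) x"
proof -
  let ?S = "\<Sum>i = 1..Suc (Suc k). K i" and ?f = "body_conv K (Suc (Suc k))"
  have "convex_body ?S" by (rule convex_body_sum) (use K in blast)
  then have "compact ?S" "?S \<noteq> {}" by (auto simp: convex_body_def simp del: sum.cl_ivl_Suc)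
  then obtain x where x: "x \<in> ?S" "\<And>y. y \<in> ?S \<Longrightarrow> ?f y \<le> ?f x"
    using continuous_attains_sup[of ?S ?f] continuous_on_subset[OF continuous_on_body_conv[of k K]] K by blast
  have b: "\<And>y. 0 \<le> ?f y" "\<And>y. y \<notin> ?S \<Longrightarrow> ?f y = 0"
    using body_conv_bounded_measurable[of "Suc k" K] K by blast+
  have "?f y \<le> ?f x" for y
    by (cases "y \<in> ?S") (auto simp: x(2) b simp del: sum.cl_ivl_Suc)
  then have "max_conv K (Suc (Suc k)) = ?f x"
    unfolding max_conv_def by (intro Greatest_equality) auto
  with x(1) that show ?thesis by blast
qed

theorem corollary5p8:
  fixes K :: "nat \<Rightarrow> (real ^ 'n) set" and m :: nat and \<theta> :: real
  assumes "m \<ge> 2"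
    and "\<And>i. i \<in> {1..m} \<Longrightarrow> convex_body (K i)"
    and "\<theta> \<in> {0..1}"
  shows "measure lebesgue (theta_sum \<theta> K m) powr (1 / real CARD('n))
       \<ge> (1 - \<theta> powr (1 / ((real m - 1) * real CARD('n))))
         * (\<Sum>i = 1..m. measure lebesgue (K i) powr (1 / real CARD('n)))"
proof -
  obtain k where m: "m = Suc (Suc k)" using assms(1) by (metis add_2_eq_Suc le_Suc_ex)
  note K = assms(2)[unfolded m]
  define S where "S = (\<Sum>i = 1..m. K i)"
  define f where "f = body_conv K m"
  define c where "c = \<theta> powr (1 / ((real m - 1) * real CARD('n)))"
  have \<theta>: "0 \<le> \<theta>" "\<theta> \<le> 1" using assms(3) by auto
  have c: "0 \<le> c" "c \<le> 1" using \<theta> by (auto simp: c_def m intro!: powr_le1)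
  \<comment> \<open>\<open>Suc k\<close> is m - 1. For \<open>\<theta> = 0\<close> also
    \<open>c = 0\<close>, since \<open>0 powr\<close> anything is 0, and the natural exponent on the
    left is positive.\<close>
  have c\<theta>: "c ^ (Suc k * CARD('n)) = \<theta>"
  proof (cases "\<theta> = 0")
    case False
    have "c ^ (Suc k * CARD('n)) = c powr real (Suc k * CARD('n))"
      using False \<theta> by (intro powr_realpow[symmetric]) (simp add: c_def)
    also have "\<dots> = \<theta> powr (1 / ((real m - 1) * real CARD('n)) * real (Suc k * CARD('n)))"
      by (simp add: c_def powr_powr)
    also have "1 / ((real m - 1) * real CARD('n)) * real (Suc k * CARD('n)) = 1"
      by (simp add: m divide_eq_1_iff add_nonneg_eq_0_iff distrib_right)
    also have "\<theta> powr 1 = \<theta>" using \<theta> by simp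
    finally show ?thesis .
  qed (simp add: c_def)
  have S: "compact S" "convex S" using convex_body_sum[of "Suc k" K, OF K]
    by (auto simp: S_def m convex_body_def simp del: sum.cl_ivl_Suc)
  obtain x where x: "x \<in> S" "max_conv K m = f x"
    using max_conv_attained[of k K, OF K] unfolding S_def f_def m by blast
  have nn: "0 \<le> f y" for y
    using body_conv_bounded_measurable[of "Suc k" K, OF K] by (simp add: f_def m del: sum.cl_ivl_Suc)
  have sub: "(\<lambda>z. (1 - c) *\<^sub>R z + c *\<^sub>R x) ` S \<subseteq> theta_sum \<theta> K m"
  proof clarify
    fix z assume z: "z \<in> S"
    have "(1 - c) *\<^sub>R z + c *\<^sub>R x \<in> S"
      using S(2) z x(1) c by (auto simp: convex_alt)
    moreover have "\<theta> * f x \<le> f ((1 - c) *\<^sub>R z + c *\<^sub>R x)"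
    \<comment> \<open>The substitution in \<open>body_conv_scale\<close> needs \<open>c > 0\<close>.
      If \<open>c = 0\<close>, then \<open>\<theta> = 0\<close> and nonnegativity of
      \<open>f\<close> suffices.\<close>
    proof (cases "c = 0")
      case True
      then have "\<theta> = 0" using c\<theta> by auto
      then show ?thesis using nn by simp
    next
      case False
      then show ?thesis
        using body_conv_scale[of "Suc k" K c z x, OF K] c z unfolding c\<theta> by (simp add: f_def S_def m del: sum.cl_ivl_Suc)
    qed
    ultimately show "(1 - c) *\<^sub>R z + c *\<^sub>R x \<in> theta_sum \<theta> K m"
      by (simp add: theta_sum_def x(2) S_def f_def)
  qed
  \<comment> \<open>Continuity makes the \<theta>-sum compact, hence of finite measure, as
    monotonicity of the measure requires below.\<close>
  have "continuous_on UNIV f" using continuous_on_body_conv[of k K, OF K] by (simp add: f_def m)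
  then have "closed {y. \<theta> * f x \<le> f y}"
    by (intro closed_Collect_le) (auto intro!: continuous_intros)
  then have "compact (S \<inter> {y. \<theta> * f x \<le> f y})" using S(1) by blast
  moreover have "theta_sum \<theta> K m = S \<inter> {y. \<theta> * f x \<le> f y}"
    by (auto simp: theta_sum_def x(2) S_def f_def)
  ultimately have meas: "theta_sum \<theta> K m \<in> lmeasurable" by (simp add: lmeasurable_compact)
  have "(1 - c) * (\<Sum>i = 1..m. root CARD('n) (measure lebesgue (K i))) \<le> (1 - c) * root CARD('n) (measure lebesgue S)"
    using brunn_minkowski_sum[of "Suc k" K, OF K] c by (intro mult_left_mono) (auto simp: S_def m simp del: sum.cl_ivl_Suc)
  also have "\<dots> = root CARD('n) ((1 - c) ^ CARD('n) * measure lebesgue S)"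
    using c by (simp add: real_root_mult real_root_power_cancel)
  \<comment> \<open>This includes \<open>c = 1\<close>, where the image is the single point
    \<open>x\<close> and both sides are 0.\<close>
  also have "(1 - c) ^ CARD('n) * measure lebesgue S = measure lebesgue ((\<lambda>z. (1 - c) *\<^sub>R z + c *\<^sub>R x) ` S)"
    using measure_lebesgue_affine[of "1 - c" "c *\<^sub>R x" S] c by simp
  also have "root CARD('n) \<dots> \<le> root CARD('n) (measure lebesgue (theta_sum \<theta> K m))"
    using sub meas S by (intro real_root_le_mono measure_mono_fmeasurable)
      (auto intro!: fmeasurableD lmeasurable_compact compact_continuous_image continuous_intros)
  finally show ?thesis
    unfolding c_def by (simp add: root_powr_inverse)
qed

end
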